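(* Fix a helper $n$, and let $\mu_n>0$, $a_n\ge 0$ and $RTT_n^{\text{data}}>0$. Assume that the runtimes $\beta_{n,i}$, $i\ge1$, of packets at helper $n$ are i.i.d. random variables with the shifted exponential distribution $$F_{\beta_{n,i}}(t)=\Pr(\beta_{n,i}<t)=1-e^{-\mu_n(t-a_n)}\quad (t\ge a_n),$$ with shift $a_n$ and mean $a_n+1/\mu_n$. Then the expected value of the duration that helper $n$ is underutilized per packet (in the worst case) is, for $i\ge 2$, $$E[Tu_{n,i}]=\begin{cases}\dfrac{1}{e\mu_n}\Big(1-e^{\mu_n RTT_n^{\text{data}}}\Big)+RTT_n^{\text{data}}, & \text{if } RTT_n^{\text{data}}<\dfrac{1}{\mu_n},\\[2mm] \dfrac{1}{e\mu_n}, & \text{otherwise.}\end{cases}$$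
   Context: A collector sends packets one after another to helper $n$; $\beta_{n,i}$ is the runtime of the $i$-th packet there, and $RTT_n^{\text{data}}>0$ is a constant, the average round-trip time between the collector and helper $n$. Packets are sent at intervals equal to the mean runtime $E[\beta_{n,i}]$, or earlier if the previous computed packet has already returned. $Tu_{n,i}$ denotes the under-utilization time, i.e. the time helper $n$ is idle between computing packet $i-1$ and packet $i$. In general it equals $\min\big(\max(\max(0,E[\beta_{n,i}]-\beta_{n,i-1})-Tq_{n,i-1},0),RTT_n^{\text{data}}\big)$, where $Tq_{n,i-1}\ge0$ is the queueing delay of packet $i-1$ at the helper. The worst case (maximal under-utilization) considered here is the one with zero queueing delay, so that $$Tu_{n,i}=\min\big(\max(0,\,E[\beta_{n,i}]-\beta_{n,i-1}),\;RTT_n^{\text{data}}\big),\qquad E[\beta_{n,i}]=a_n+1/\mu_n .$$ *)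

theory Defs
  imports "HOL-Probability.Probability"
begin

text \<open>
  The mean $a + 1/\mu$ is not part of the definition: it follows from the distribution function,
  which also forces $X \ge a$ almost surely (take $t = a$).
\<close>

definition shifted_exponential :: "'w measure \<Rightarrow> real \<Rightarrow> real \<Rightarrow> ('w \<Rightarrow> real) \<Rightarrow> bool" where
  "shifted_exponential M a \<mu> X \<longleftrightarrow>
     X \<in> borel_measurable M \<and>
     (\<forall>t\<ge>a. measure M {\<omega> \<in> space M. X \<omega> < t} = 1 - exp (- \<mu> * (t - a)))"

text \<open>
  For a fixed helper, \<open>\<beta> i\<close> is the runtime of packet \<open>i\<close>, \<open>Tq i\<close> its queueing delay, and
  \<open>R\<close> the average round-trip time. Packets are numbered from 1, so the idle time before packet
  \<open>i\<close> is meaningful for \<open>i \<ge> 2\<close> only.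
\<close>

definition under_utilization ::
  "'w measure \<Rightarrow> (nat \<Rightarrow> 'w \<Rightarrow> real) \<Rightarrow> (nat \<Rightarrow> 'w \<Rightarrow> real) \<Rightarrow> real \<Rightarrow> nat \<Rightarrow> 'w \<Rightarrow> real" where
  "under_utilization M \<beta> Tq R i \<omega> =
     min (max (max 0 (integral\<^sup>L M (\<beta> i) - \<beta> (i - 1) \<omega>) - Tq (i - 1) \<omega>) 0) R"

definition worst_under_utilization ::
  "'w measure \<Rightarrow> (nat \<Rightarrow> 'w \<Rightarrow> real) \<Rightarrow> real \<Rightarrow> nat \<Rightarrow> 'w \<Rightarrow> real" where
  "worst_under_utilization M \<beta> R = under_utilization M \<beta> (\<lambda>_ _. 0) R"

lemma worst_under_utilization_eq:
  "worst_under_utilization M \<beta> R i \<omega> = min (max 0 (integral\<^sup>L M (\<beta> i) - \<beta> (i - 1) \<omega>)) R"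
  by (simp add: worst_under_utilization_def under_utilization_def)

lemma under_utilization_le_worst:
  assumes "0 \<le> Tq (i - 1) \<omega>"
  shows "under_utilization M \<beta> Tq R i \<omega> \<le> worst_under_utilization M \<beta> R i \<omega>"
  using assms by (auto simp: worst_under_utilization_def under_utilization_def)

end

theory Submission
  imports Defs
begin

text \<open>
  The shifted runtime \<open>X = \<beta> - a\<close> is exponential with rate \<open>\<mu>\<close>. Since
  \<open>min (max 0 (m - x)) R = max 0 (m - x) - max 0 (m - R - x)\<close> for \<open>R \<ge> 0\<close>, the worst-case idle time
  is a difference of positive parts \<open>max 0 (b - X)\<close>, whose expectation is
  \<open>b - 1 / \<mu> + exp (- b * \<mu>) / \<mu>\<close> for \<open>b \<ge> 0\<close>, and 0 otherwise.
\<close>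

text \<open>
  The definition of \<open>shifted_exponential\<close> gives \<open>P(X < t)\<close>; continuity of the distribution
  function yields \<open>P(X \<le> t)\<close>.
\<close>

lemma (in prob_space) shifted_exponential_distributed:
  assumes X: "shifted_exponential M a \<mu> X" and "\<mu> > 0"
  shows "distributed M lborel (\<lambda>\<omega>. X \<omega> - a) (exponential_density \<mu>)"
proof -
  have [measurable]: "X \<in> borel_measurable M"
    and cdf: "\<And>t. t \<ge> a \<Longrightarrow> \<P>(\<omega> in M. X \<omega> < t) = 1 - exp (- \<mu> * (t - a))"
    using X by (auto simp: shifted_exponential_def)
  have "\<P>(\<omega> in M. X \<omega> - a \<le> t) = 1 - exp (- t * \<mu>)" if "t \<ge> 0" for t
  proof (rule antisym)
    \<comment> \<open>Only strict events have a known probability, so the slack \<open>e\<close>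
      enlarges the closed event to a strict one; letting \<open>e\<close> tend to 0 from the right
      removes it.\<close>
    have upper: "\<P>(\<omega> in M. X \<omega> - a \<le> t) \<le> 1 - exp (- \<mu> * (t + e))" if "e > 0" for e
    proof -
      have "\<P>(\<omega> in M. X \<omega> - a \<le> t) \<le> \<P>(\<omega> in M. X \<omega> < a + t + e)"
        using that by (intro finite_measure_mono) auto
      also have "\<dots> = 1 - exp (- \<mu> * (t + e))"
        using cdf[of "a + t + e"] that \<open>t \<ge> 0\<close> by (simp add: algebra_simps)
      finally show ?thesis .
    qed
    have "((\<lambda>e. 1 - exp (- \<mu> * (t + e))) \<longlongrightarrow> 1 - exp (- \<mu> * (t + 0))) (at_right 0)"
      by (intro tendsto_intros)
    then have "\<P>(\<omega> in M. X \<omega> - a \<le> t) \<le> 1 - exp (- \<mu> * (t + 0))"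
      by (rule tendsto_lowerbound)
        (use upper in \<open>auto intro!: eventually_mono[OF eventually_at_right_less]\<close>)
    then show "\<P>(\<omega> in M. X \<omega> - a \<le> t) \<le> 1 - exp (- t * \<mu>)"
      by (simp add: mult.commute)
  next
    have "1 - exp (- t * \<mu>) = \<P>(\<omega> in M. X \<omega> < a + t)"
      using cdf[of "a + t"] that by (simp add: mult.commute)
    also have "\<dots> \<le> \<P>(\<omega> in M. X \<omega> - a \<le> t)"
      by (intro finite_measure_mono) auto
    finally show "1 - exp (- t * \<mu>) \<le> \<P>(\<omega> in M. X \<omega> - a \<le> t)" .
  qed
  then show ?thesis
    using \<open>\<mu> > 0\<close> by (subst exponential_distributed_iff) auto
qed

text \<open>A non-integrable function has integral 0 by convention, whereas the expectation here is
  \<open>1 / l\<close>, which is nonzero.\<close>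

lemma (in prob_space) exponential_distributed_integrable:
  assumes "0 < l" and "distributed M lborel X (exponential_density l)"
  shows "integrable M X"
  using exponential_distributed_expectation[OF assms] \<open>0 < l\<close> not_integrable_integral_eq
  by fastforce

lemma (in prob_space) exponential_distributed_expectation_pos_part:
  assumes "0 < l" and X: "distributed M lborel X (exponential_density l)"
  shows "expectation (\<lambda>\<omega>. max 0 (b - X \<omega>)) = (if b \<ge> 0 then b - 1 / l + exp (- b * l) / l else 0)"
proof -
  have eq: "expectation (\<lambda>\<omega>. max 0 (b - X \<omega>)) =
      (\<integral>x. exponential_density l x * max 0 (b - x) \<partial>lborel)"
    using \<open>0 < l\<close> by (intro distributed_integral[OF X, symmetric]) (auto simp: exponential_density_nonneg)
  show ?thesis
  proof (cases "b \<ge> 0")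
    case True
    \<comment> \<open>Antiderivative of \<open>?f\<close>, found by integration by parts;
      \<open>?F b\<close> is \<open>exp (- b * l) / l\<close> and \<open>- ?F 0\<close> is
      \<open>b - 1 / l\<close>.\<close>
    let ?F = "\<lambda>x. (x - b + 1 / l) * exp (- x * l)"
    let ?f = "\<lambda>x. l * exp (- x * l) * (b - x)"
    \<comment> \<open>The density vanishes below 0 and the positive part above \<open>b\<close>, so
      only the interval from 0 to \<open>b\<close> contributes.\<close>
    have "(\<integral>x. exponential_density l x * max 0 (b - x) \<partial>lborel) =
        (\<integral>x. indicator {0..b} x *\<^sub>R ?f x \<partial>lborel)"
      by (intro Bochner_Integration.integral_cong)
        (auto simp: exponential_density_def indicator_def)
    also have "\<dots> = ?F b - ?F 0"
    proof (rule integral_FTC_atLeastAtMost[OF True])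
      show "(?F has_vector_derivative ?f x) (at x within {0..b})" for x
        unfolding has_real_derivative_iff_has_vector_derivative[symmetric]
        using \<open>0 < l\<close> by (auto intro!: derivative_eq_intros simp: field_simps)
      show "continuous_on {0..b} ?f"
        by (intro continuous_intros)
    qed
    finally show ?thesis
      using True eq by simp
  next
    case False
    then have "(\<lambda>x. exponential_density l x * max 0 (b - x)) = (\<lambda>_. 0)"
      by (auto simp: exponential_density_def)
    then show ?thesis
      using False unfolding eq by simp
  qed
qed

theorem theorem4:
  fixes M :: "'w measure" and \<beta> :: "nat \<Rightarrow> 'w \<Rightarrow> real" and \<mu> a RTT :: real and i :: nat
  assumes "prob_space M"
    and "\<mu> > 0" and "a \<ge> 0" and "RTT > 0"
    and "prob_space.indep_vars M (\<lambda>_. borel) \<beta> {1..}"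
    and "\<And>j. j \<ge> 1 \<Longrightarrow> shifted_exponential M a \<mu> (\<beta> j)"
    and "i \<ge> 2"
  shows "integral\<^sup>L M (worst_under_utilization M \<beta> RTT i) =
    (if RTT < 1 / \<mu>
     then 1 / (exp 1 * \<mu>) * (1 - exp (\<mu> * RTT)) + RTT
     else 1 / (exp 1 * \<mu>))"
proof -
  interpret prob_space M by fact
  define X where "X j \<omega> = \<beta> j \<omega> - a" for j \<omega>
  have D: "distributed M lborel (X j) (exponential_density \<mu>)" if "j \<ge> 1" for j
    using shifted_exponential_distributed[OF assms(6)[OF that] \<open>\<mu> > 0\<close>] by (simp add: X_def[abs_def])
  note int = exponential_distributed_integrable[OF \<open>\<mu> > 0\<close> D]
  \<comment> \<open>The mean belongs to packet \<open>i\<close>, the random runtime to packet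
    \<open>i - 1\<close>; the distribution is known for both since \<open>i \<ge> 2\<close>.\<close>
  have "expectation (\<beta> i) = expectation (\<lambda>\<omega>. X i \<omega> + a)"
    by (simp add: X_def)
  also have "\<dots> = 1 / \<mu> + a"
    using int[of i] exponential_distributed_expectation[OF \<open>\<mu> > 0\<close> D[of i]] \<open>i \<ge> 2\<close>
    by (simp add: prob_space)
  finally have mean: "expectation (\<beta> i) = 1 / \<mu> + a" .
  have i: "i - 1 \<ge> 1"
    using \<open>i \<ge> 2\<close> by simp
  note pos_part = exponential_distributed_expectation_pos_part[OF \<open>\<mu> > 0\<close> D[OF i]]
  \<comment> \<open>The shift \<open>a\<close> cancels between the mean and the runtime, which is
    why the result does not depend on it.\<close>
  have "worst_under_utilization M \<beta> RTT i =
      (\<lambda>\<omega>. max 0 (1 / \<mu> - X (i - 1) \<omega>) - max 0 (1 / \<mu> - RTT - X (i - 1) \<omega>))"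
    using \<open>RTT > 0\<close> by (auto simp: fun_eq_iff worst_under_utilization_eq mean X_def)
  then have "expectation (worst_under_utilization M \<beta> RTT i) =
      expectation (\<lambda>\<omega>. max 0 (1 / \<mu> - X (i - 1) \<omega>)) -
      expectation (\<lambda>\<omega>. max 0 (1 / \<mu> - RTT - X (i - 1) \<omega>))"
    using int[OF i] by (simp add: Bochner_Integration.integral_diff)
  \<comment> \<open>The thresholds are \<open>b = 1 / \<mu>\<close>, where
    \<open>b - 1 / \<mu>\<close> vanishes, and \<open>b = 1 / \<mu> - RTT\<close>, which is negative
    for large \<open>RTT\<close>.\<close>
  also have "\<dots> = exp (- 1) / \<mu> -
      (if RTT \<le> 1 / \<mu> then exp (\<mu> * RTT - 1) / \<mu> - RTT else 0)"
    unfolding pos_part using \<open>\<mu> > 0\<close> by (simp add: algebra_simps)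
  \<comment> \<open>Passing from \<open>\<le>\<close> to \<open><\<close> is harmless: at
    \<open>RTT = 1 / \<mu>\<close> the subtracted term is 0.\<close>
  also have "\<dots> = (if RTT < 1 / \<mu>
     then 1 / (exp 1 * \<mu>) * (1 - exp (\<mu> * RTT)) + RTT
     else 1 / (exp 1 * \<mu>))"
    using \<open>\<mu> > 0\<close> by (auto simp: exp_diff exp_minus field_simps)
  finally show ?thesis .
qed

end
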